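(* Let $H_n$ denote $\mathbb{R}^n$ or $\mathbb{C}^n$, let $F=\{f_i\}_{i\in I}\subseteq H_n$, $I=\{1,\dots,k\}$, be a unit-norm frame, and let $w\in\mathbb{R}_{\ge 0}^k$ be a scaling of $F$. Then $w$ is non-prime if and only if $w$ is a convex combination, with strictly positive coefficients, of a set of minimal scalings of $F$ which can be partitioned into two nonempty orthogonal subsets (that is, nonempty subsets $C$ and $D$ with $\langle v,v'\rangle=0$ for all $v\in C$, $v'\in D$).
   Context: A frame for $H_n$ is a finite sequence spanning $H_n$; it is unit-norm if each vector has norm $1$. It is tight if there is $\lambda>0$ with $\sum_i|\langle x,f_i\rangle|^2=\lambda\|x\|^2$ for all $x\in H_n$, and Parseval if this holds with $\lambda=1$. A scaling of $F=\{f_i\}_{i=1}^k$ is a vector $w=(w(1),\dots,w(k))\in\mathbb{R}_{\ge0}^k$ such that $\{\sqrt{w(i)}f_i\}_{i\in I}$ is a Parseval frame for $H_n$. $F$ (or any subfamily) is scalable if it has a scaling. A scaling $w$ is minimal if $\{f_i:w(i)>0\}$ has no proper scalable subset (subsets taken with respect to indices). A scaling $w$ is prime if the scaled frame contains no proper tight subframe, and non-prime otherwise. Here zero vectors of the scaled frame are disregarded: $w$ is non-prime iff there is $J\subsetneq\{i:w(i)>0\}$ such that $\{\sqrt{w(i)}f_i\}_{i\in J}$ is a tight frame for $H_n$. *)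

theory Defs
  imports "HOL-Analysis.Analysis" "Jordan_Normal_Form.Conjugate"
begin

text \<open>
  The space is 'a^'n with 'a = real or 'a = complex; the definitions are polymorphic so that both
  cases share them. The library inner product on complex^'n is only the real part of the
  Hermitian one, so the latter is defined here; over the reals conjugation is the identity.
  The norm is the library norm on vectors, which is Euclidean in both cases.
\<close>

definition hermitian_inner ::
  "'a::{real_normed_field, conjugatable_field}^'n \<Rightarrow> 'a^'n \<Rightarrow> 'a"
  where "hermitian_inner x y = (\<Sum>j\<in>UNIV. x $ j * conjugate (y $ j))"

text \<open>
  Families are indexed by a finite type 'k; a subfamily is given by a set of indices, so that
  repeated vectors remain distinct members. Note that \<^term>\<open>vec.span\<close> is the span over the
  scalar field 'a, whereas \<^term>\<open>span\<close> would be the real span.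
\<close>

definition frame_on ::
  "'k::finite set \<Rightarrow> ('k \<Rightarrow> 'a::{real_normed_field, conjugatable_field}^'n) \<Rightarrow> bool"
  where "frame_on J g \<longleftrightarrow> vec.span (g ` J) = UNIV"

definition tight_frame_on ::
  "'k::finite set \<Rightarrow> ('k \<Rightarrow> 'a::{real_normed_field, conjugatable_field}^'n) \<Rightarrow> bool"
  where "tight_frame_on J g \<longleftrightarrow> frame_on J g \<and>
    (\<exists>a>0. \<forall>x. (\<Sum>i\<in>J. (norm (hermitian_inner x (g i)))\<^sup>2) = a * (norm x)\<^sup>2)"

definition parseval_frame_on ::
  "'k::finite set \<Rightarrow> ('k \<Rightarrow> 'a::{real_normed_field, conjugatable_field}^'n) \<Rightarrow> bool"
  where "parseval_frame_on J g \<longleftrightarrow> frame_on J g \<and>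
    (\<forall>x. (\<Sum>i\<in>J. (norm (hermitian_inner x (g i)))\<^sup>2) = (norm x)\<^sup>2)"

definition unit_norm_frame ::
  "('k::finite \<Rightarrow> 'a::{real_normed_field, conjugatable_field}^'n) \<Rightarrow> bool"
  where "unit_norm_frame f \<longleftrightarrow> frame_on UNIV f \<and> (\<forall>i. norm (f i) = 1)"

definition scaled_family ::
  "('k::finite \<Rightarrow> 'a::{real_normed_field, conjugatable_field}^'n) \<Rightarrow> ('k \<Rightarrow> real) \<Rightarrow> 'k \<Rightarrow> 'a^'n"
  where "scaled_family f c = (\<lambda>i. sqrt (c i) *\<^sub>R f i)"

text \<open>Values of c outside J are irrelevant.\<close>

definition scaling_on ::
  "'k::finite set \<Rightarrow> ('k \<Rightarrow> 'a::{real_normed_field, conjugatable_field}^'n) \<Rightarrow> ('k \<Rightarrow> real) \<Rightarrow> bool"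
  where "scaling_on J f c \<longleftrightarrow> (\<forall>i\<in>J. 0 \<le> c i) \<and> parseval_frame_on J (scaled_family f c)"

definition scalable_on ::
  "'k::finite set \<Rightarrow> ('k \<Rightarrow> 'a::{real_normed_field, conjugatable_field}^'n) \<Rightarrow> bool"
  where "scalable_on J f \<longleftrightarrow> (\<exists>c. scaling_on J f c)"

definition scaling ::
  "('k::finite \<Rightarrow> 'a::{real_normed_field, conjugatable_field}^'n) \<Rightarrow> real^'k \<Rightarrow> bool"
  where "scaling f w \<longleftrightarrow> scaling_on UNIV f (\<lambda>i. w $ i)"

definition minimal_scaling ::
  "('k::finite \<Rightarrow> 'a::{real_normed_field, conjugatable_field}^'n) \<Rightarrow> real^'k \<Rightarrow> bool"
  where "minimal_scaling f w \<longleftrightarrow>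
    scaling f w \<and> \<not> (\<exists>J. J \<subset> {i. w $ i > 0} \<and> scalable_on J f)"

text \<open>Zero vectors of the scaled frame are disregarded when subframes are formed.\<close>

definition prime_scaling ::
  "('k::finite \<Rightarrow> 'a::{real_normed_field, conjugatable_field}^'n) \<Rightarrow> real^'k \<Rightarrow> bool"
  where "prime_scaling f w \<longleftrightarrow> scaling f w \<and>
    \<not> (\<exists>J. J \<subset> {i. w $ i > 0} \<and> tight_frame_on J (scaled_family f (\<lambda>i. w $ i)))"

end

theory Submission
  imports Defs
begin

text \<open>
  The scalings of a family form a polytope: the nonnegative \<open>w\<close> satisfying the linear equations
  \<open>\<Sum>i. w i * |\<langle>x, f i\<rangle>|\<^sup>2 = \<parallel>x\<parallel>\<^sup>2\<close>, one for every \<open>x\<close>. If \<open>v\<close> is a scaling whose support is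
  strictly contained in that of \<open>w\<close>, then moving from \<open>v\<close> through \<open>w\<close> until a coordinate vanishes
  exhibits \<open>w\<close> as a convex combination of scalings of smaller support; by induction every scaling
  is a convex combination of minimal scalings supported inside it. A proper tight subframe
  with bound \<open>a\<close> leaves a tight complement with bound \<open>1 - a > 0\<close>, so \<open>w\<close> is the corresponding
  convex combination of two scalings with disjoint supports, and both can be decomposed.
  Conversely, nonnegative vectors are orthogonal iff their supports are disjoint, so the union of
  the supports of \<open>C\<close> carries a tight subframe.
\<close>

section \<open>Convex geometry of supports and weights\<close>

definition supp :: "real^'k \<Rightarrow> 'k set"
  where "supp w = {i. w $ i > 0}"

text \<open>Dropping the zero terms of an explicit convex combination leaves strictly positive
  coefficients, as the theorem demands.\<close>

lemma convex_hull_positive_coeffs: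
  fixes P :: "'a::real_vector set"
  assumes "w \<in> convex hull P"
  obtains M u where "finite M" "M \<noteq> {}" "M \<subseteq> P" "\<And>v. v \<in> M \<Longrightarrow> 0 < u v" "sum u M = 1"
    "w = (\<Sum>v\<in>M. u v *\<^sub>R v)"
proof -
  obtain S u where S: "finite S" "S \<subseteq> P" "\<forall>v\<in>S. 0 \<le> u v" "sum u S = 1" "(\<Sum>v\<in>S. u v *\<^sub>R v) = w"
    using assms by (auto simp: convex_hull_explicit)
  define M where "M = {v \<in> S. u v \<noteq> 0}"
  have "sum u M = sum u S" "(\<Sum>v\<in>M. u v *\<^sub>R v) = (\<Sum>v\<in>S. u v *\<^sub>R v)"
    unfolding M_def by (rule sum.mono_neutral_left; use S in auto)+
  with S have sums: "sum u M = 1" "w = (\<Sum>v\<in>M. u v *\<^sub>R v)"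
    by auto
  then have "M \<noteq> {}"
    by auto
  moreover have "finite M" "M \<subseteq> P" "\<And>v. v \<in> M \<Longrightarrow> 0 < u v"
    using S unfolding M_def by (auto simp: order_less_le)
  ultimately show thesis
    using that sums by blast
qed

text \<open>\<open>x\<close> runs over test vectors; for a frame, \<open>q x i\<close> will be
  \<open>|<x, f i>|^2\<close> and \<open>b x\<close> the squared norm of \<open>x\<close>. In this
  form the scalar field disappears from the argument.\<close>

locale weight_polytope =
  fixes q :: "'x \<Rightarrow> 'k::finite \<Rightarrow> real" and b :: "'x \<Rightarrow> real"
  assumes q_nonneg: "0 \<le> q x i"
    and q_pos: "\<exists>x. 0 < q x i"
    and b_nonzero: "\<exists>x. b x \<noteq> 0"
begin

definition weights :: "(real^'k) set"
  where "weights = {w. (\<forall>i. 0 \<le> w $ i) \<and> (\<forall>x. (\<Sum>i\<in>UNIV. w $ i * q x i) = b x)}"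

text \<open>These are the vertices of the polytope, described by inclusion-minimal support to match
  \<open>minimal_scaling\<close>.\<close>

definition min_weights :: "(real^'k) set"
  where "min_weights = {w \<in> weights. \<not> (\<exists>v\<in>weights. supp v \<subset> supp w)}"

lemma weightsD:
  assumes "w \<in> weights"
  shows "0 \<le> w $ i" "(\<Sum>i\<in>UNIV. w $ i * q x i) = b x"
  using assms by (auto simp: weights_def)

lemma supp_nonempty:
  assumes "w \<in> weights"
  shows "supp w \<noteq> {}"
proof
  assume "supp w = {}"
  then have "w $ i = 0" for i
    using weightsD(1)[OF assms, of i] by (auto simp: supp_def order_less_le)
  then show False
    using weightsD(2)[OF assms] b_nonzero by auto
qed

text \<open>The nonnegative differences \<open>w $ i - v $ i\<close> have weighted sum 0 for every
  \<open>x\<close>, and each index \<open>i\<close> is detected by some \<open>x\<close> with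
  \<open>0 < q x i\<close>.\<close>

lemma weights_antisym:
  assumes v: "v \<in> weights" and w: "w \<in> weights" and le: "\<And>i. v $ i \<le> w $ i"
  shows "v = w"
proof -
  have "v $ i = w $ i" for i
  proof -
    obtain x where x: "0 < q x i"
      using q_pos by blast
    have "(\<Sum>i\<in>UNIV. (w $ i - v $ i) * q x i) = 0"
      using weightsD(2)[OF v] weightsD(2)[OF w] by (simp add: left_diff_distrib sum_subtractf)
    then have "(w $ i - v $ i) * q x i = 0"
      using le q_nonneg by (subst (asm) sum_nonneg_eq_0_iff) auto
    with x show ?thesis
      by simp
  qed
  then show ?thesis
    by (simp add: vec_eq_iff)
qed

lemma in_hull_min_weights:
  assumes "w \<in> weights"
  shows "w \<in> convex hull {v \<in> min_weights. supp v \<subseteq> supp w}"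
  using assms
proof (induction "card (supp w)" arbitrary: w rule: less_induct)
  case less
  note w = \<open>w \<in> weights\<close>
  let ?H = "\<lambda>w. {v \<in> min_weights. supp v \<subseteq> supp w}"
  have IH: "v \<in> convex hull (?H w)" if "v \<in> weights" "supp v \<subset> supp w" for v
  proof -
    have "v \<in> convex hull (?H v)"
      using less that by (simp add: psubset_card_mono)
    moreover have "?H v \<subseteq> ?H w"
      using that by blast
    ultimately show ?thesis
      using hull_mono by blast
  qed
  show ?case
  proof (cases "w \<in> min_weights")
    case True
    then show ?thesis
      by (simp add: hull_inc)
  next
    case False
    with w obtain v where v: "v \<in> weights" "supp v \<subset> supp w"
      by (auto simp: min_weights_def)
    \<comment> \<open>The largest \<open>t\<close> with \<open>t * v $ i \<le> w $ i\<close> for all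
      \<open>i\<close>; equality holds at a minimising \<open>j\<close>, so \<open>w - t v\<close>
      loses the coordinate \<open>j\<close>.\<close>
    define t where "t = Min ((\<lambda>i. w $ i / v $ i) ` supp v)"
    have "t \<in> (\<lambda>i. w $ i / v $ i) ` supp v"
      unfolding t_def using supp_nonempty[OF v(1)] by (intro Min_in) auto
    then obtain j where j: "j \<in> supp v" "t = w $ j / v $ j"
      by blast
    have t_nonneg: "0 \<le> t"
      using j weightsD(1)[OF w] by (auto simp: supp_def)
    have tv: "t * v $ i \<le> w $ i" for i
    proof (cases "i \<in> supp v")
      case True
      then have "t \<le> w $ i / v $ i"
        unfolding t_def by (intro Min_le) auto
      with True show ?thesis
        by (simp add: supp_def pos_le_divide_eq)
    next
      case False
      then have "v $ i = 0"
        using weightsD(1)[OF v(1), of i] by (simp add: supp_def)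
      then show ?thesis
        using weightsD(1)[OF w] by simp
    qed
    have "t < 1"
    proof (rule ccontr)
      assume "\<not> t < 1"
      then have "v $ i \<le> w $ i" for i
        using tv[of i] mult_right_mono[of 1 t "v $ i"] weightsD(1)[OF v(1), of i] by simp
      then have "v = w"
        using weights_antisym v w by blast
      with v show False
        by simp
    qed
    \<comment> \<open>The far end of the ray from \<open>v\<close> through \<open>w\<close>. The
      equations for \<open>w - t v\<close> have right-hand side \<open>(1 - t) * b x\<close>, which
      the factor restores to \<open>b x\<close>.\<close>
    define z where "z = (1 / (1 - t)) *\<^sub>R (w - t *\<^sub>R v)"
    have z_nth: "z $ i = (w $ i - t * v $ i) / (1 - t)" for i
      by (simp add: z_def)
    have "z \<in> weights"
      unfolding weights_def
    proof (safe)
      show "0 \<le> z $ i" for i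
        using tv[of i] \<open>t < 1\<close> by (simp add: z_nth)
      show "(\<Sum>i\<in>UNIV. z $ i * q x i) = b x" for x
      proof -
        have "(\<Sum>i\<in>UNIV. z $ i * q x i)
            = ((\<Sum>i\<in>UNIV. w $ i * q x i) - t * (\<Sum>i\<in>UNIV. v $ i * q x i)) / (1 - t)"
          by (simp add: z_nth left_diff_distrib sum_subtractf sum_distrib_left mult.assoc
              flip: sum_divide_distrib)
        then show ?thesis
          using \<open>t < 1\<close>
          by (simp add: weightsD(2)[OF w] weightsD(2)[OF v(1)] divide_eq_eq right_diff_distrib mult.commute)
      qed
    qed
    moreover have "supp z \<subset> supp w"
    proof
      show "supp z \<subseteq> supp w"
      proof
        fix i assume "i \<in> supp z"
        then have "t * v $ i < w $ i"
          using \<open>t < 1\<close> by (simp add: supp_def z_nth zero_less_divide_iff)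
        moreover have "0 \<le> t * v $ i"
          using t_nonneg weightsD(1)[OF v(1)] by simp
        ultimately show "i \<in> supp w"
          by (simp add: supp_def)
      qed
      have "j \<in> supp w" "j \<notin> supp z"
        using j v by (auto simp: supp_def z_nth)
      then show "supp z \<noteq> supp w"
        by blast
    qed
    ultimately have "z \<in> convex hull (?H w)" "v \<in> convex hull (?H w)"
      using IH v by auto
    then have "t *\<^sub>R v + (1 - t) *\<^sub>R z \<in> convex hull (?H w)"
      using t_nonneg \<open>t < 1\<close> by (intro convexD[OF convex_convex_hull]) auto
    moreover have "t *\<^sub>R v + (1 - t) *\<^sub>R z = w"
      using \<open>t < 1\<close> by (simp add: z_def)
    ultimately show ?thesis
      by simp
  qed
qed

lemma min_weights_combination:
  assumes "w \<in> weights"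
  obtains M u where "finite M" "M \<noteq> {}" "M \<subseteq> min_weights" "\<And>v. v \<in> M \<Longrightarrow> supp v \<subseteq> supp w"
    "\<And>v. v \<in> M \<Longrightarrow> 0 < u v" "sum u M = 1" "w = (\<Sum>v\<in>M. u v *\<^sub>R v)"
proof -
  obtain M u where "finite M" "M \<noteq> {}" "M \<subseteq> {v \<in> min_weights. supp v \<subseteq> supp w}"
    "\<And>v. v \<in> M \<Longrightarrow> 0 < u v" "sum u M = 1" "w = (\<Sum>v\<in>M. u v *\<^sub>R v)"
    by (rule convex_hull_positive_coeffs[OF in_hull_min_weights[OF assms]]) (rule that)
  then show thesis
    by (intro that[of M u]) auto
qed

lemma inner_eq_0_iff_disjoint_supp:
  assumes "v \<in> weights" "w \<in> weights"
  shows "v \<bullet> w = 0 \<longleftrightarrow> supp v \<inter> supp w = {}"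
proof -
  have "v \<bullet> w = 0 \<longleftrightarrow> (\<forall>i. v $ i * w $ i = 0)"
    unfolding inner_vec_def
    by (subst sum_nonneg_eq_0_iff) (auto simp: weightsD(1)[OF assms(1)] weightsD(1)[OF assms(2)])
  also have "\<dots> \<longleftrightarrow> supp v \<inter> supp w = {}"
    using weightsD(1)[OF assms(1)] weightsD(1)[OF assms(2)]
    by (auto simp: supp_def order_less_le)
  finally show ?thesis .
qed

text \<open>Division by \<open>a\<close> renormalises the partial sum over \<open>J\<close>. It
  serves for a tight part with bound \<open>a\<close> and for its complement with bound
  \<open>1 - a\<close>.\<close>

lemma restrict_weights:
  assumes w: "w \<in> weights" and "0 < a" and J: "\<And>x. (\<Sum>i\<in>J. w $ i * q x i) = a * b x"
  defines "v \<equiv> \<chi> i. if i \<in> J then w $ i / a else 0"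
  shows "v \<in> weights"
  unfolding weights_def
proof safe
  show "0 \<le> v $ i" for i
    using weightsD(1)[OF w] \<open>0 < a\<close> by (simp add: v_def)
  fix x
  have "(\<Sum>i\<in>UNIV. v $ i * q x i) = (\<Sum>i\<in>UNIV. if i \<in> J then w $ i * q x i / a else 0)"
    by (rule sum.cong) (auto simp: v_def)
  also have "\<dots> = (\<Sum>i\<in>J. w $ i * q x i) / a"
    by (simp add: sum.If_cases sum_divide_distrib)
  finally show "(\<Sum>i\<in>UNIV. v $ i * q x i) = b x"
    using \<open>0 < a\<close> J by simp
qed

section \<open>Tight splittings and orthogonal decompositions\<close>

lemma orthogonal_decomposition_of_split:
  assumes w: "w \<in> weights" and J: "J \<subset> supp w"
    and a: "0 < a" "\<And>x. (\<Sum>i\<in>J. w $ i * q x i) = a * b x"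
  shows "\<exists>M u C D. finite M \<and> M \<subseteq> min_weights \<and> (\<forall>v\<in>M. 0 < u v) \<and> sum u M = 1 \<and>
    w = (\<Sum>v\<in>M. u v *\<^sub>R v) \<and> C \<union> D = M \<and> C \<inter> D = {} \<and> C \<noteq> {} \<and> D \<noteq> {} \<and>
    (\<forall>v\<in>C. \<forall>v'\<in>D. v \<bullet> v' = 0)"
proof -
  \<comment> \<open>The complement is taken among all indices: those outside \<open>supp w\<close>
    have weight 0 and contribute nothing.\<close>
  have compl: "(\<Sum>i\<in>-J. w $ i * q x i) = (1 - a) * b x" for x
    using sum.subset_diff[of J UNIV "\<lambda>i. w $ i * q x i"] weightsD(2)[OF w, of x] a(2)[of x]
    by (simp add: Compl_eq_Diff_UNIV algebra_simps)
  obtain j where j: "j \<in> supp w" "j \<notin> J"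
    using J by blast
  \<comment> \<open>Properness of \<open>J\<close> leaves a positive weight at \<open>j\<close>; a
    test vector that detects \<open>j\<close> makes the complementary sum positive.\<close>
  have a_lt: "a < 1"
  proof -
    obtain x where x: "0 < q x j"
      using q_pos by blast
    have "0 < w $ j * q x j"
      using j x by (simp add: supp_def)
    also have "\<dots> \<le> (\<Sum>i\<in>-J. w $ i * q x i)"
      using j by (intro member_le_sum) (auto simp: q_nonneg weightsD(1)[OF w])
    finally have "0 < (1 - a) * b x"
      by (simp add: compl)
    moreover have "0 \<le> b x"
      unfolding weightsD(2)[OF w, of x, symmetric]
      by (intro sum_nonneg mult_nonneg_nonneg weightsD(1)[OF w] q_nonneg)
    ultimately show ?thesis
      by (simp add: zero_less_mult_iff)
  qed
  define p where "p = (\<chi> i. if i \<in> J then w $ i / a else 0)"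
  define r where "r = (\<chi> i. if i \<in> -J then w $ i / (1 - a) else 0)"
  have p: "p \<in> weights" and r: "r \<in> weights"
    unfolding p_def r_def using w a compl a_lt by (auto intro!: restrict_weights simp del: Compl_iff)
  have disj: "supp p \<inter> supp r = {}"
    by (auto simp: supp_def p_def r_def)
  have w_eq: "w = a *\<^sub>R p + (1 - a) *\<^sub>R r"
    using a a_lt by (simp add: vec_eq_iff p_def r_def)
  obtain C s where C: "finite C" "C \<noteq> {}" "C \<subseteq> min_weights" "\<And>v. v \<in> C \<Longrightarrow> supp v \<subseteq> supp p"
    "\<And>v. v \<in> C \<Longrightarrow> 0 < s v" "sum s C = 1" "p = (\<Sum>v\<in>C. s v *\<^sub>R v)"
    using min_weights_combination[OF p] by blast
  obtain D t where D: "finite D" "D \<noteq> {}" "D \<subseteq> min_weights" "\<And>v. v \<in> D \<Longrightarrow> supp v \<subseteq> supp r"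
    "\<And>v. v \<in> D \<Longrightarrow> 0 < t v" "sum t D = 1" "r = (\<Sum>v\<in>D. t v *\<^sub>R v)"
    using min_weights_combination[OF r] by blast
  have weights: "C \<subseteq> weights" "D \<subseteq> weights"
    using C D by (auto simp: min_weights_def)
  have CD_supp: "supp v \<inter> supp v' = {}" if "v \<in> C" "v' \<in> D" for v v'
    using that C(4) D(4) disj by blast
  then have orth: "v \<bullet> v' = 0" if "v \<in> C" "v' \<in> D" for v v'
    using that weights inner_eq_0_iff_disjoint_supp by blast
  \<comment> \<open>A common member would have support disjoint from itself, hence empty.\<close>
  have CD: "C \<inter> D = {}"
    using CD_supp supp_nonempty weights by (metis disjoint_iff inf.idem subsetD)
  \<comment> \<open>The two decompositions are weighted by the coefficients of \<open>p\<close> and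
    \<open>r\<close> in \<open>w_eq\<close>; disjointness of \<open>C\<close> and \<open>D\<close>
    makes the case split consistent.\<close>
  define u where "u v = (if v \<in> C then a * s v else (1 - a) * t v)" for v
  have uC: "u v = a * s v" if "v \<in> C" for v
    using that by (simp add: u_def)
  have uD: "u v = (1 - a) * t v" if "v \<in> D" for v
    using that CD by (auto simp: u_def)
  have "sum u (C \<union> D) = sum u C + sum u D"
    using C D CD by (intro sum.union_disjoint) auto
  also have "\<dots> = 1"
    by (simp add: uC uD C D flip: sum_distrib_left)
  finally have "sum u (C \<union> D) = 1" .
  moreover have "(\<Sum>v\<in>C \<union> D. u v *\<^sub>R v) = w"
  proof -
    have "(\<Sum>v\<in>C \<union> D. u v *\<^sub>R v) = (\<Sum>v\<in>C. u v *\<^sub>R v) + (\<Sum>v\<in>D. u v *\<^sub>R v)"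
      using C D CD by (intro sum.union_disjoint) auto
    also have "\<dots> = a *\<^sub>R p + (1 - a) *\<^sub>R r"
      by (simp add: uC uD C(7) D(7) scaleR_sum_right)
    finally show ?thesis
      by (simp add: w_eq)
  qed
  moreover have "\<forall>v\<in>C \<union> D. 0 < u v"
    using C(5) D(5) a a_lt uC uD by auto
  moreover have "finite (C \<union> D)" "C \<union> D \<subseteq> min_weights"
    using C D by auto
  ultimately show ?thesis
    using CD C(2) D(2) orth by (intro exI[of _ "C \<union> D"] exI[of _ u] exI[of _ C] exI[of _ D]) simp
qed

text \<open>On the union \<open>J\<close> of the supports of \<open>C\<close>, all members of
  \<open>D\<close> vanish, so \<open>w\<close> agrees there with its \<open>C\<close>-part; summing
  the equations of those members yields the bound \<open>a = sum u C\<close>.\<close>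

lemma split_of_orthogonal_decomposition:
  assumes "finite M" "M \<subseteq> weights" "\<And>v. v \<in> M \<Longrightarrow> 0 < u v" and w: "w = (\<Sum>v\<in>M. u v *\<^sub>R v)"
    and "C \<union> D = M" "C \<inter> D = {}" "C \<noteq> {}" "D \<noteq> {}" and orth: "\<forall>v\<in>C. \<forall>v'\<in>D. v \<bullet> v' = 0"
  shows "\<exists>J a. J \<subset> supp w \<and> 0 < a \<and> (\<forall>x. (\<Sum>i\<in>J. w $ i * q x i) = a * b x)"
proof -
  have fin: "finite C" "finite D"
    using assms by auto
  have CM: "v \<in> weights" "0 < u v" if "v \<in> C \<union> D" for v
    using assms that by auto
  have disj: "supp v \<inter> supp v' = {}" if "v \<in> C" "v' \<in> D" for v v'
    using inner_eq_0_iff_disjoint_supp[of v v'] CM orth that by simp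
  define J where "J = (\<Union>v\<in>C. supp v)"
  have w_nth: "w $ i = (\<Sum>v\<in>C. u v * v $ i) + (\<Sum>v\<in>D. u v * v $ i)" for i
    using fin assms(5,6) by (auto simp: w sum.union_disjoint)
  \<comment> \<open>All terms are nonnegative, so nothing cancels in the combination.\<close>
  have supp_sub: "supp v \<subseteq> supp w" if "v \<in> C \<union> D" for v
  proof
    fix i assume "i \<in> supp v"
    then have "0 < u v * v $ i"
      using CM that by (simp add: supp_def)
    also have "\<dots> \<le> (\<Sum>v\<in>M. u v * v $ i)"
      using assms that CM by (intro member_le_sum) (auto simp: weightsD(1) less_imp_le)
    finally show "i \<in> supp w"
      by (simp add: supp_def w)
  qed
  \<comment> \<open>Any index in the support of a member of \<open>D\<close> lies in
    \<open>supp w\<close> but outside \<open>J\<close>, so \<open>J\<close> is proper.\<close>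
  obtain d where d: "d \<in> D"
    using assms by blast
  obtain j where j: "j \<in> supp d"
    using supp_nonempty CM d by blast
  have "j \<in> supp w" "j \<notin> J"
    using supp_sub[of d] d j disj unfolding J_def by blast+
  then have "J \<subset> supp w"
    using supp_sub by (auto simp: J_def)
  moreover have "0 < sum u C"
    using fin assms(7) CM by (intro sum_pos) auto
  moreover have "(\<Sum>i\<in>J. w $ i * q x i) = sum u C * b x" for x
  proof -
    have wJ: "w $ i = (\<Sum>v\<in>C. u v * v $ i)" if "i \<in> J" for i
    proof -
      have "v $ i = 0" if "v \<in> D" for v
      proof -
        have "i \<notin> supp v"
          using \<open>i \<in> J\<close> that disj by (auto simp: J_def)
        then show ?thesis
          using weightsD(1)[OF CM(1), of v i] that by (simp add: supp_def)
      qed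
      then show ?thesis
        by (simp add: w_nth)
    qed
    have C_off: "v $ i = 0" if "v \<in> C" "i \<notin> J" for v i
      using that weightsD(1)[OF CM(1), of v i] by (force simp: supp_def J_def)
    have "(\<Sum>i\<in>J. w $ i * q x i) = (\<Sum>i\<in>J. \<Sum>v\<in>C. u v * v $ i * q x i)"
      by (simp add: wJ sum_distrib_right)
    \<comment> \<open>Members of \<open>C\<close> vanish off \<open>J\<close>, so the sum extends to
      all indices, where their equations apply.\<close>
    also have "\<dots> = (\<Sum>i\<in>UNIV. \<Sum>v\<in>C. u v * v $ i * q x i)"
      by (rule sum.mono_neutral_left) (auto simp: C_off)
    also have "\<dots> = (\<Sum>v\<in>C. \<Sum>i\<in>UNIV. u v * v $ i * q x i)"
      by (rule sum.swap)
    also have "\<dots> = (\<Sum>v\<in>C. u v * (\<Sum>i\<in>UNIV. v $ i * q x i))"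
      by (simp add: sum_distrib_left mult.assoc)
    also have "\<dots> = (\<Sum>v\<in>C. u v * b x)"
      by (rule sum.cong) (auto simp: weightsD(2)[OF CM(1)])
    finally show ?thesis
      by (simp add: sum_distrib_right)
  qed
  ultimately show ?thesis
    by blast
qed

theorem split_iff_orthogonal_decomposition:
  assumes "w \<in> weights"
  shows "(\<exists>J a. J \<subset> supp w \<and> 0 < a \<and> (\<forall>x. (\<Sum>i\<in>J. w $ i * q x i) = a * b x)) \<longleftrightarrow>
    (\<exists>M u C D. finite M \<and> M \<subseteq> min_weights \<and> (\<forall>v\<in>M. 0 < u v) \<and> sum u M = 1 \<and>
      w = (\<Sum>v\<in>M. u v *\<^sub>R v) \<and> C \<union> D = M \<and> C \<inter> D = {} \<and> C \<noteq> {} \<and> D \<noteq> {} \<and>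
      (\<forall>v\<in>C. \<forall>v'\<in>D. v \<bullet> v' = 0))" (is "?L \<longleftrightarrow> ?R")
proof
  assume ?L
  then obtain J a where "J \<subset> supp w" "0 < a" "\<And>x. (\<Sum>i\<in>J. w $ i * q x i) = a * b x"
    by auto
  then show ?R
    by (rule orthogonal_decomposition_of_split[OF assms])
next
  assume ?R
  then obtain M u C D where "finite M" "M \<subseteq> min_weights" "\<forall>v\<in>M. 0 < u v"
    "w = (\<Sum>v\<in>M. u v *\<^sub>R v)" "C \<union> D = M" "C \<inter> D = {}" "C \<noteq> {}" "D \<noteq> {}"
    "\<forall>v\<in>C. \<forall>v'\<in>D. v \<bullet> v' = 0"
    by blast
  moreover from this have "M \<subseteq> weights"
    by (auto simp: min_weights_def)
  ultimately show ?L
    by (intro split_of_orthogonal_decomposition[of M u w C D]) auto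
qed

end

section \<open>Spanning from the tight frame identity\<close>

lemma frame_on_if_hermitian_inner_separates:
  fixes h :: "'k::finite \<Rightarrow> 'a::{real_normed_field, conjugatable_field}^'n"
  assumes "\<And>y. (\<And>i. i \<in> J \<Longrightarrow> hermitian_inner y (h i) = 0) \<Longrightarrow> y = 0"
  shows "frame_on J h"
proof -
  \<comment> \<open>Rows outside \<open>J\<close> are set to 0, since the index type is fixed; a
    trivial kernel of \<open>A\<close> makes its rows span.\<close>
  define A :: "'a^'n^'k" where "A = (\<chi> i. if i \<in> J then h i else 0)"
  have "x = 0" if x: "A *v x = 0" for x
  proof -
    \<comment> \<open>\<open>A *v x\<close> involves no conjugation while
      \<open>hermitian_inner\<close> conjugates its second argument, so the vector orthogonal to the
      \<open>h i\<close> is the conjugate of \<open>x\<close>.\<close>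
    define y where "y = (\<chi> j. conjugate (x $ j))"
    have "hermitian_inner y (h i) = 0" if "i \<in> J" for i
    proof -
      have "(\<Sum>j\<in>UNIV. h i $ j * x $ j) = 0"
        using x that by (auto simp: vec_eq_iff A_def matrix_vector_mult_def dest: spec[of _ i])
      then have "conjugate (\<Sum>j\<in>UNIV. h i $ j * x $ j) = 0"
        by simp
      then show ?thesis
        by (simp add: hermitian_inner_def y_def sum_conjugate conjugate_dist_mul mult.commute)
    qed
    then have "y = 0"
      using assms by blast
    then show ?thesis
      by (simp add: y_def vec_eq_iff)
  qed
  then have "vec.span (rows A) = UNIV"
    using matrix_left_invertible_ker matrix_left_invertible_span_rows_gen[of A] by blast
  moreover have "rows A \<subseteq> insert 0 (h ` J)"
    by (auto simp: rows_def row_def A_def)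
  ultimately have "vec.span (insert 0 (h ` J)) = UNIV"
    using vec.span_mono[of "rows A" "insert 0 (h ` J)"] by (metis top.extremum_uniqueI)
  then show ?thesis
    by (simp add: frame_on_def vec.span_insert_0)
qed

text \<open>By the identity, a vector orthogonal to all \<open>h i\<close> has norm 0. This reduces
  tightness of a scaled family to equations in its weights.\<close>

lemma frame_on_if_tight_identity:
  fixes h :: "'k::finite \<Rightarrow> 'a::{real_normed_field, conjugatable_field}^'n"
  assumes "0 < a" "\<And>x. (\<Sum>i\<in>J. (norm (hermitian_inner x (h i)))\<^sup>2) = a * (norm x)\<^sup>2"
  shows "frame_on J h"
proof (rule frame_on_if_hermitian_inner_separates)
  fix y assume "\<And>i. i \<in> J \<Longrightarrow> hermitian_inner y (h i) = 0"
  then have "a * (norm y)\<^sup>2 = 0"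
    by (simp flip: assms(2))
  with \<open>0 < a\<close> show "y = 0"
    by simp
qed

section \<open>Scalings of a unit-norm frame as weights\<close>

text \<open>
  The field \<open>'a\<close> stands for the reals or the complex numbers; real linearity of
  \<^const>\<open>conjugate\<close> does not follow from its class.
\<close>

context
  fixes f :: "'k::finite \<Rightarrow> 'a::{real_normed_field, conjugatable_field}^'n"
  assumes unit_norm: "unit_norm_frame f"
    and conjugate_scaleR: "\<And>s (z::'a). conjugate (s *\<^sub>R z) = s *\<^sub>R conjugate z"
begin

text \<open>Squaring removes the square root, making the frame identities linear in
  \<open>c\<close>.\<close>

lemma hermitian_inner_scaled_family:
  assumes "0 \<le> c i"
  shows "(norm (hermitian_inner x (scaled_family f c i)))\<^sup>2 = c i * (norm (hermitian_inner x (f i)))\<^sup>2"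
proof -
  have "hermitian_inner x (scaled_family f c i) = sqrt (c i) *\<^sub>R hermitian_inner x (f i)"
    by (simp add: hermitian_inner_def scaled_family_def conjugate_scaleR scaleR_sum_right)
  then show ?thesis
    using assms by (simp add: power_mult_distrib)
qed

lemma tight_frame_on_scaled_family_iff:
  assumes "\<And>i. i \<in> J \<Longrightarrow> 0 \<le> c i"
  shows "tight_frame_on J (scaled_family f c) \<longleftrightarrow>
    (\<exists>a>0. \<forall>x. (\<Sum>i\<in>J. c i * (norm (hermitian_inner x (f i)))\<^sup>2) = a * (norm x)\<^sup>2)"
proof -
  have "tight_frame_on J (scaled_family f c) \<longleftrightarrow>
    (\<exists>a>0. \<forall>x. (\<Sum>i\<in>J. (norm (hermitian_inner x (scaled_family f c i)))\<^sup>2) = a * (norm x)\<^sup>2)"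
    using frame_on_if_tight_identity unfolding tight_frame_on_def by blast
  then show ?thesis
    using assms by (simp add: hermitian_inner_scaled_family)
qed

lemma scaling_on_iff:
  "scaling_on J f c \<longleftrightarrow> (\<forall>i\<in>J. 0 \<le> c i) \<and>
    (\<forall>x. (\<Sum>i\<in>J. c i * (norm (hermitian_inner x (f i)))\<^sup>2) = (norm x)\<^sup>2)"
proof -
  have "parseval_frame_on J (scaled_family f c) \<longleftrightarrow>
    (\<forall>x. (\<Sum>i\<in>J. (norm (hermitian_inner x (scaled_family f c i)))\<^sup>2) = (norm x)\<^sup>2)"
    using frame_on_if_tight_identity[where a = 1 and h = "scaled_family f c"]
    unfolding parseval_frame_on_def by auto
  then show ?thesis
    by (auto simp: scaling_on_def hermitian_inner_scaled_family)
qed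

interpretation weight_polytope "\<lambda>x i. (norm (hermitian_inner x (f i)))\<^sup>2" "\<lambda>x. (norm x)\<^sup>2"
proof
  fix i
  have "f i \<noteq> 0"
    using unit_norm unfolding unit_norm_frame_def by (metis norm_zero zero_neq_one)
  then obtain j where "f i $ j \<noteq> 0"
    by (auto simp: vec_eq_iff)
  \<comment> \<open>Pairing with a coordinate vector gives the conjugate of the nonzero entry
    \<open>f i $ j\<close>.\<close>
  then have "hermitian_inner (axis j 1) (f i) \<noteq> 0"
    by (simp add: hermitian_inner_def axis_def if_distrib[of "\<lambda>z. z * _"] cong: if_cong)
  then show "\<exists>x. 0 < (norm (hermitian_inner x (f i)))\<^sup>2"
    by (intro exI[of _ "axis j 1"]) simp
next
  \<comment> \<open>\<open>undefined\<close> stands for an arbitrary coordinate; index types are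
    nonempty, so the space is nonzero.\<close>
  have "(axis undefined 1 :: 'a^'n) \<noteq> 0"
    by (simp add: axis_eq_0_iff)
  then show "\<exists>x::'a^'n. (norm x)\<^sup>2 \<noteq> 0"
    by (metis norm_eq_zero power_eq_0_iff)
qed simp

lemma scaling_iff_weights: "scaling f w \<longleftrightarrow> w \<in> weights"
  by (simp add: scaling_def scaling_on_iff weights_def)

text \<open>Since \<open>scaling_on\<close> ignores values outside \<open>J\<close>, a scaling of
  the subfamily can be extended by zero, which turns scalability into a condition on
  supports.\<close>

lemma scalable_on_iff: "scalable_on J f \<longleftrightarrow> (\<exists>v\<in>weights. supp v \<subseteq> J)"
proof
  assume "scalable_on J f"
  then obtain c where c: "scaling_on J f c"
    by (auto simp: scalable_on_def)
  define v :: "real^'k" where "v = (\<chi> i. if i \<in> J then c i else 0)"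
  have "(\<Sum>i\<in>UNIV. v $ i * y i) = (\<Sum>i\<in>J. c i * y i)" for y
    by (rule sum.mono_neutral_cong_right) (auto simp: v_def)
  then have "v \<in> weights"
    using c by (simp add: scaling_on_iff weights_def) (simp add: v_def)
  moreover have "supp v \<subseteq> J"
    by (auto simp: supp_def v_def split: if_splits)
  ultimately show "\<exists>v\<in>weights. supp v \<subseteq> J"
    by blast
next
  assume "\<exists>v\<in>weights. supp v \<subseteq> J"
  then obtain v where v: "v \<in> weights" "supp v \<subseteq> J"
    by blast
  have "v $ i = 0" if "i \<notin> J" for i
    using that v weightsD(1)[OF v(1), of i] by (force simp: supp_def)
  then have "(\<Sum>i\<in>J. v $ i * y i) = (\<Sum>i\<in>UNIV. v $ i * y i)" for y
    by (intro sum.mono_neutral_left) auto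
  then have "scaling_on J f (\<lambda>i. v $ i)"
    using v by (simp add: scaling_on_iff weightsD)
  then show "scalable_on J f"
    by (auto simp: scalable_on_def)
qed

text \<open>A scalable \<open>J\<close> contains the support of some weight vector, and conversely
  such a support is itself a scalable index set.\<close>

lemma minimal_scaling_iff: "minimal_scaling f w \<longleftrightarrow> w \<in> min_weights"
  unfolding minimal_scaling_def scaling_iff_weights scalable_on_iff min_weights_def
  by (auto simp: supp_def)

lemma not_prime_scaling_iff:
  assumes w: "scaling f w"
  shows "\<not> prime_scaling f w \<longleftrightarrow>
    (\<exists>M u C D. finite M \<and> (\<forall>v\<in>M. minimal_scaling f v) \<and>
      (\<forall>v\<in>M. 0 < u v) \<and> (\<Sum>v\<in>M. u v) = 1 \<and> w = (\<Sum>v\<in>M. u v *\<^sub>R v) \<and>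
      C \<union> D = M \<and> C \<inter> D = {} \<and> C \<noteq> {} \<and> D \<noteq> {} \<and>
      (\<forall>v\<in>C. \<forall>v'\<in>D. v \<bullet> v' = 0))"
proof -
  have weights: "w \<in> weights"
    using w by (simp add: scaling_iff_weights)
  have "\<not> prime_scaling f w \<longleftrightarrow> (\<exists>J a. J \<subset> supp w \<and> 0 < a \<and>
      (\<forall>x. (\<Sum>i\<in>J. w $ i * (norm (hermitian_inner x (f i)))\<^sup>2) = a * (norm x)\<^sup>2))"
    using w by (simp add: prime_scaling_def tight_frame_on_scaled_family_iff weightsD(1)[OF weights] supp_def)
  then show ?thesis
    unfolding split_iff_orthogonal_decomposition[OF weights] by (simp only: minimal_scaling_iff subset_eq)
qed

end

section \<open>The real and complex cases\<close>

theorem theorem12: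
  fixes f :: "'k::finite \<Rightarrow> real^'n" and g :: "'k \<Rightarrow> complex^'n" and w :: "real^'k"
  shows
    "(unit_norm_frame f \<and> scaling f w \<longrightarrow>
      (\<not> prime_scaling f w \<longleftrightarrow>
        (\<exists>M u C D. finite M \<and> (\<forall>v\<in>M. minimal_scaling f v) \<and>
          (\<forall>v\<in>M. 0 < u v) \<and> (\<Sum>v\<in>M. u v) = 1 \<and> w = (\<Sum>v\<in>M. u v *\<^sub>R v) \<and>
          C \<union> D = M \<and> C \<inter> D = {} \<and> C \<noteq> {} \<and> D \<noteq> {} \<and>
          (\<forall>v\<in>C. \<forall>v'\<in>D. v \<bullet> v' = 0)))) \<and>
     (unit_norm_frame g \<and> scaling g w \<longrightarrow>
      (\<not> prime_scaling g w \<longleftrightarrow>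
        (\<exists>M u C D. finite M \<and> (\<forall>v\<in>M. minimal_scaling g v) \<and>
          (\<forall>v\<in>M. 0 < u v) \<and> (\<Sum>v\<in>M. u v) = 1 \<and> w = (\<Sum>v\<in>M. u v *\<^sub>R v) \<and>
          C \<union> D = M \<and> C \<inter> D = {} \<and> C \<noteq> {} \<and> D \<noteq> {} \<and>
          (\<forall>v\<in>C. \<forall>v'\<in>D. v \<bullet> v' = 0))))"
proof -
  \<comment> \<open>Both fields satisfy the real linearity of \<open>conjugate\<close> that the
    general result assumes.\<close>
  have "conjugate (s *\<^sub>R z) = s *\<^sub>R conjugate z" for s and z :: real
    by simp
  moreover have "conjugate (s *\<^sub>R z) = s *\<^sub>R conjugate z" for s and z :: complex
    by (simp add: conjugate_complex_def)
  ultimately show ?thesis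
    by (intro conjI impI; elim conjE; intro not_prime_scaling_iff)
qed

end
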